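(* Fix a time period $t$. Let $d_t=(d_{1,t},\dots,d_{M,t})\in\mathbb{R}^M$ satisfy $\underline{d}_{m,t}\le d_{m,t}\le \overline{d}_{m,t}$ for all $m\in\{1,\dots,M\}$, and let $\tilde d_{k,t}=\sum_{j=1}^{n_k} d_{h^{(k)}_j,t}$ for $k\in\{1,\dots,K\}$. Suppose $p_t=(p_{1,t},\dots,p_{I,t})\in\mathbb{R}^I$ satisfies $$\sum_{i=1}^I p_{i,t}=\sum_{k=1}^K \tilde d_{k,t}$$ and, for every $l\in\{1,\dots,L\}$, $$-F_l+\sum_{k=1}^K\varepsilon_{l,k}\;\le\;\sum_{i=1}^I\Gamma^U_{l,i}p_{i,t}-\sum_{k=1}^K\left(\alpha_{l,k}\tilde d_{k,t}+\beta_{l,k}\right)\;\le\;F_l-\sum_{k=1}^K\varepsilon_{l,k}.$$ Then $p_t$ also satisfies $$\sum_{i=1}^I p_{i,t}=\sum_{m=1}^M d_{m,t}$$ and, for every $l\in\{1,\dots,L\}$, $$-F_l\;\le\;\sum_{i=1}^I\Gamma^U_{l,i}p_{i,t}-\sum_{m=1}^M\Gamma^D_{l,m}d_{m,t}\;\le\;F_l .$$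
   Context: A power system has $I$ thermal units, $M$ uncertain nodal loads and $L$ transmission lines. $\Gamma^U\in\mathbb{R}^{L\times I}$ and $\Gamma^D\in\mathbb{R}^{L\times M}$ are given real matrices (power transmission distribution factors), $F\in\mathbb{R}^{L}$ is the vector of transmission limits, $p_{i,t}$ is the generation level of unit $i$ in period $t$, and $d_{m,t}$ is the net load $m$ in period $t$, with given real bounds $\underline{d}_{m,t}\le\overline{d}_{m,t}$. The index set of the loads is partitioned into $K\le M$ mutually exclusive (nonempty) subsets $$\{1,\dots,M\}=\{h^{(1)}_1,\dots,h^{(1)}_{n_1}\}\cup\cdots\cup\{h^{(K)}_1,\dots,h^{(K)}_{n_K}\},\qquad n_1+\cdots+n_K=M.$$ $\alpha,\beta\in\mathbb{R}^{L\times K}$ are real approximation parameters, and $\varepsilon_{l,k}$ is the corresponding maximum approximation error of subset $k$ on line $l$, i.e. the maximum of $$\left|\sum_{j=1}^{n_k}\Gamma^D_{l,h^{(k)}_j}d_{h^{(k)}_j,t}-\left(\alpha_{l,k}\sum_{j=1}^{n_k}d_{h^{(k)}_j,t}+\beta_{l,k}\right)\right|$$ over all $d_t$ with $\underline{d}_{m,t}\le d_{m,t}\le\overline{d}_{m,t}$ for all $m$. *)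

theory Defs
  imports "HOL-Analysis.Analysis"
begin

text \<open>
  Units, loads, lines and load subsets are indexed by the finite types \<open>'i\<close>, \<open>'m\<close>, \<open>'l\<close>, \<open>'k\<close>.
  The \<open>k\<close>-th subset of loads is listed as \<open>h k 1, \<dots>, h k (n k)\<close>; values of \<open>h k\<close> outside
  \<open>{1..n k}\<close> are irrelevant.
\<close>

definition load_partition :: "('k::finite \<Rightarrow> nat) \<Rightarrow> ('k \<Rightarrow> nat \<Rightarrow> 'm::finite) \<Rightarrow> bool" where
  "load_partition n h \<longleftrightarrow>
     (\<forall>k. n k \<ge> 1) \<and>
     (\<forall>k. inj_on (h k) {1..n k}) \<and>
     (\<forall>k k'. k \<noteq> k' \<longrightarrow> h k ` {1..n k} \<inter> h k' ` {1..n k'} = {}) \<and>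
     (\<Union>k. h k ` {1..n k}) = UNIV"

lemma load_partition_sum:
  fixes n :: "'k::finite \<Rightarrow> nat" and h :: "'k \<Rightarrow> nat \<Rightarrow> 'm::finite"
  assumes "load_partition n h"
  shows "(\<Sum>k\<in>UNIV. n k) = CARD('m)"
proof -
  have "CARD('m) = card (\<Union>k. h k ` {1..n k})"
    using assms by (simp add: load_partition_def)
  also have "\<dots> = (\<Sum>k\<in>UNIV. card (h k ` {1..n k}))"
    using assms by (intro card_UN_disjoint) (auto simp: load_partition_def)
  also have "\<dots> = (\<Sum>k\<in>UNIV. n k)"
    using assms by (intro sum.cong) (auto simp: load_partition_def card_image)
  finally show ?thesis by simp
qed

lemma load_partition_card_le:
  fixes n :: "'k::finite \<Rightarrow> nat" and h :: "'k \<Rightarrow> nat \<Rightarrow> 'm::finite"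
  assumes "load_partition n h"
  shows "CARD('k) \<le> CARD('m)"
proof -
  have "(\<Sum>k\<in>(UNIV::'k set). 1) \<le> (\<Sum>k\<in>UNIV. n k)"
    using assms by (intro sum_mono) (auto simp: load_partition_def)
  then show ?thesis using load_partition_sum[OF assms] by simp
qed

definition load_box :: "real^'m::finite \<Rightarrow> real^'m \<Rightarrow> (real^'m) set" where
  "load_box lo hi = {d. \<forall>m. lo $ m \<le> d $ m \<and> d $ m \<le> hi $ m}"

definition agg_load :: "('k::finite \<Rightarrow> nat) \<Rightarrow> ('k \<Rightarrow> nat \<Rightarrow> 'm::finite) \<Rightarrow> real^'m \<Rightarrow> real^'k" where
  "agg_load n h d = (\<chi> k. \<Sum>j=1..n k. d $ h k j)"

definition approx_error ::
    "('k::finite \<Rightarrow> nat) \<Rightarrow> ('k \<Rightarrow> nat \<Rightarrow> 'm::finite) \<Rightarrow> real^'m^'l::finite \<Rightarrow>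
     real^'k^'l \<Rightarrow> real^'k^'l \<Rightarrow> real^'m \<Rightarrow> 'l \<Rightarrow> 'k \<Rightarrow> real" where
  "approx_error n h \<Gamma>D \<alpha> \<beta> d l k =
     \<bar>(\<Sum>j=1..n k. \<Gamma>D $ l $ h k j * d $ h k j) -
      (\<alpha> $ l $ k * (\<Sum>j=1..n k. d $ h k j) + \<beta> $ l $ k)\<bar>"

text \<open>
  The maximum is meant literally, as the greatest element of the set of values; it exists for
  \<open>lo \<le> hi\<close> because the error is continuous and the box is compact and nonempty.
\<close>

definition max_approx_error ::
    "('k::finite \<Rightarrow> nat) \<Rightarrow> ('k \<Rightarrow> nat \<Rightarrow> 'm::finite) \<Rightarrow> real^'m^'l::finite \<Rightarrow>
     real^'k^'l \<Rightarrow> real^'k^'l \<Rightarrow> real^'m \<Rightarrow> real^'m \<Rightarrow> 'l \<Rightarrow> 'k \<Rightarrow> real" where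
  "max_approx_error n h \<Gamma>D \<alpha> \<beta> lo hi l k =
     (GREATEST e. e \<in> (\<lambda>d. approx_error n h \<Gamma>D \<alpha> \<beta> d l k) ` load_box lo hi)"

end

theory Submission
  imports Defs
begin

text \<open>
  The load subsets partition the loads, so every sum over loads splits into a sum over subsets. For
  the loads themselves this turns the aggregated balance into the original one. For the load flow
  on a line it shows that replacing the exact contribution of every subset by its affine
  approximation changes the total by at most the sum over the subsets of the individual errors
  (triangle inequality), and each of these is at most its maximum over the box. The aggregated
  line limits were tightened by exactly this amount, so the original limits follow.

  The one analytic ingredient is that the maximum is attained (\<open>approx_error_le_max\<close>): a
  \<open>GREATEST\<close> carries information only when a greatest element exists, which holds here by
  compactness of the box.
\<close>

lemma sum_load_partition:
  fixes g :: "'m::finite \<Rightarrow> 'a::comm_monoid_add" and n :: "'k::finite \<Rightarrow> nat"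
  assumes "load_partition n h"
  shows "(\<Sum>m\<in>UNIV. g m) = (\<Sum>k\<in>UNIV. \<Sum>j=1..n k. g (h k j))"
proof -
  have "(\<Sum>m\<in>UNIV. g m) = (\<Sum>m\<in>(\<Union>k. h k ` {1..n k}). g m)"
    using assms by (simp add: load_partition_def)
  also have "\<dots> = (\<Sum>k\<in>UNIV. \<Sum>m\<in>h k ` {1..n k}. g m)"
    using assms by (intro sum.UNION_disjoint) (auto simp: load_partition_def)
  also have "\<dots> = (\<Sum>k\<in>UNIV. \<Sum>j=1..n k. g (h k j))"
    using assms by (intro sum.cong) (auto simp: load_partition_def sum.reindex)
  finally show ?thesis .
qed

lemma load_box_eq_cbox: "load_box lo hi = cbox lo hi"
  by (auto simp: load_box_def mem_box_cart)

lemma continuous_on_approx_error: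
  "continuous_on S (\<lambda>d. approx_error n h \<Gamma>D \<alpha> \<beta> d l k)"
  unfolding approx_error_def by (intro continuous_intros)

text \<open>
  The error is continuous and the box is compact, and nonempty because it contains \<open>d\<close>, so a
  greatest error value exists and \<open>max_approx_error\<close> denotes it.
\<close>

lemma approx_error_le_max:
  assumes "d \<in> load_box lo hi"
  shows "approx_error n h \<Gamma>D \<alpha> \<beta> d l k \<le> max_approx_error n h \<Gamma>D \<alpha> \<beta> lo hi l k"
proof -
  let ?f = "\<lambda>d. approx_error n h \<Gamma>D \<alpha> \<beta> d l k"
  have "compact (load_box lo hi)" "load_box lo hi \<noteq> {}"
    using assms by (auto simp: load_box_eq_cbox)
  then obtain x where x: "x \<in> load_box lo hi" "\<forall>y\<in>load_box lo hi. ?f y \<le> ?f x"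
    using continuous_attains_sup[OF _ _ continuous_on_approx_error] by blast
  have "max_approx_error n h \<Gamma>D \<alpha> \<beta> lo hi l k = ?f x"
    unfolding max_approx_error_def using x by (intro Greatest_equality) auto
  with x assms show ?thesis by simp
qed

text \<open>
  This is why tightening by the sum of the maximal errors suffices: split along the subsets, the
  difference of exact and aggregated flow is the sum of the signed subset errors, so the triangle
  inequality bounds it by the sum of their absolute values.
\<close>

lemma aggregated_flow_error:
  assumes "load_partition n h" and "d \<in> load_box lo hi"
  shows "\<bar>(\<Sum>m\<in>UNIV. \<Gamma>D $ l $ m * d $ m)
            - (\<Sum>k\<in>UNIV. \<alpha> $ l $ k * agg_load n h d $ k + \<beta> $ l $ k)\<bar>
         \<le> (\<Sum>k\<in>UNIV. max_approx_error n h \<Gamma>D \<alpha> \<beta> lo hi l k)"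
proof -
  have "\<bar>(\<Sum>m\<in>UNIV. \<Gamma>D $ l $ m * d $ m)
          - (\<Sum>k\<in>UNIV. \<alpha> $ l $ k * agg_load n h d $ k + \<beta> $ l $ k)\<bar>
        = \<bar>\<Sum>k\<in>UNIV. (\<Sum>j=1..n k. \<Gamma>D $ l $ h k j * d $ h k j)
             - (\<alpha> $ l $ k * (\<Sum>j=1..n k. d $ h k j) + \<beta> $ l $ k)\<bar>"
    by (simp only: sum_load_partition[OF assms(1)] agg_load_def vec_lambda_beta sum_subtractf)
  also have "\<dots> \<le> (\<Sum>k\<in>UNIV. approx_error n h \<Gamma>D \<alpha> \<beta> d l k)"
    unfolding approx_error_def by (rule sum_abs)
  also have "\<dots> \<le> (\<Sum>k\<in>UNIV. max_approx_error n h \<Gamma>D \<alpha> \<beta> lo hi l k)"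
    by (intro sum_mono approx_error_le_max assms)
  finally show ?thesis .
qed

theorem theorem1:
  fixes \<Gamma>U :: "real^'i::finite^'l::finite"
    and \<Gamma>D :: "real^'m::finite^'l"
    and F :: "real^'l"
    and dlo dhi d :: "nat \<Rightarrow> real^'m"
    and p :: "nat \<Rightarrow> real^'i"
    and n :: "'k::finite \<Rightarrow> nat"
    and h :: "'k \<Rightarrow> nat \<Rightarrow> 'm"
    and \<alpha> \<beta> :: "real^'k^'l"
    and \<epsilon> :: "'l \<Rightarrow> 'k \<Rightarrow> real"
    and dt :: "real^'k"
    and t :: nat
  assumes bounds: "\<And>m. dlo t $ m \<le> dhi t $ m"
    and partition: "load_partition n h"
    and eps: "\<And>l k. \<epsilon> l k = max_approx_error n h \<Gamma>D \<alpha> \<beta> (dlo t) (dhi t) l k"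
    and d_in: "d t \<in> load_box (dlo t) (dhi t)"
    and dt: "dt = agg_load n h (d t)"
    and balance: "(\<Sum>i\<in>UNIV. p t $ i) = (\<Sum>k\<in>UNIV. dt $ k)"
    and lines: "\<And>l. - F $ l + (\<Sum>k\<in>UNIV. \<epsilon> l k)
                  \<le> (\<Sum>i\<in>UNIV. \<Gamma>U $ l $ i * p t $ i)
                    - (\<Sum>k\<in>UNIV. \<alpha> $ l $ k * dt $ k + \<beta> $ l $ k) \<and>
                (\<Sum>i\<in>UNIV. \<Gamma>U $ l $ i * p t $ i)
                    - (\<Sum>k\<in>UNIV. \<alpha> $ l $ k * dt $ k + \<beta> $ l $ k)
                  \<le> F $ l - (\<Sum>k\<in>UNIV. \<epsilon> l k)"
  shows "(\<Sum>i\<in>UNIV. p t $ i) = (\<Sum>m\<in>UNIV. d t $ m) \<and>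
    (\<forall>l. - F $ l \<le> (\<Sum>i\<in>UNIV. \<Gamma>U $ l $ i * p t $ i) - (\<Sum>m\<in>UNIV. \<Gamma>D $ l $ m * d t $ m) \<and>
         (\<Sum>i\<in>UNIV. \<Gamma>U $ l $ i * p t $ i) - (\<Sum>m\<in>UNIV. \<Gamma>D $ l $ m * d t $ m) \<le> F $ l)"
proof (intro conjI allI)
  show "(\<Sum>i\<in>UNIV. p t $ i) = (\<Sum>m\<in>UNIV. d t $ m)"
    using balance by (simp add: sum_load_partition[OF partition] dt agg_load_def)
next
  fix l
  have err: "\<bar>(\<Sum>m\<in>UNIV. \<Gamma>D $ l $ m * d t $ m)
               - (\<Sum>k\<in>UNIV. \<alpha> $ l $ k * dt $ k + \<beta> $ l $ k)\<bar> \<le> (\<Sum>k\<in>UNIV. \<epsilon> l k)"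
    unfolding dt eps by (rule aggregated_flow_error[OF partition d_in])
  show "- F $ l \<le> (\<Sum>i\<in>UNIV. \<Gamma>U $ l $ i * p t $ i) - (\<Sum>m\<in>UNIV. \<Gamma>D $ l $ m * d t $ m)"
    using err lines[of l] by linarith
  show "(\<Sum>i\<in>UNIV. \<Gamma>U $ l $ i * p t $ i) - (\<Sum>m\<in>UNIV. \<Gamma>D $ l $ m * d t $ m) \<le> F $ l"
    using err lines[of l] by linarith
qed

end
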